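(* Let $p>1$ and let $H=(V,E,W)$ be a connected hypergraph with nonempty labeled set $L\subset V$ and labels $y_i\in\mathbb{R}$ ($x_i\in L$). Let $u:V\to\mathbb{R}$ be a minimizer of $F_H^{con}$, let $D=D(u)\subset V$ be its set of determined vertices, and let $\beta_k\in\arg\max_{b\in B_k}\langle b,u\rangle$, $k=1,\dots,m$, be vectors such that $$\Big(\sum_{k=1}^m w_k\max_{x_s,x_t\in e_k}|u(x_s)-u(x_t)|^{p-1}\beta_k\Big)(x_i)=0\quad\text{for all }x_i\in V\setminus L .$$ For $x_i\in D$ put $\alpha_k(x_i)=|\beta_k(x_i)|$ if $x_i\in e_k$ and $\alpha_k(x_i)=0$ if $x_i\notin e_k$. Then $u|_D$ is a solution of the hypergraph $p$-Laplacian equation on $D$, i.e. $v=u|_D$ satisfies $$\sum_{k=1}^m w_k\,\alpha_k(x_i)\,\Big|\max_{x_j\in e_k\cap D}v(x_j)+\min_{x_j\in e_k\cap D}v(x_j)-2v(x_i)\Big|^{p-2}\Big(\max_{x_j\in e_k\cap D}v(x_j)+\min_{x_j\in e_k\cap D}v(x_j)-2v(x_i)\Big)=0$$ for all $x_i\in D\setminus L$, and $v(x_i)=y_i$ for all $x_i\in L$.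
   Context: A hypergraph $H=(V,E,W)$ consists of a finite vertex set $V=\{x_i\}_{i=1}^n\subset\mathbb{R}^d$, a finite family of hyperedges $E=\{e_k\}_{k=1}^m$ (nonempty subsets of $V$) and positive weights $W=\{w_k\}_{k=1}^m$. It is connected if for any $x_i,x_j\in V$ there are hyperedges $e_{k_1},\dots,e_{k_l}\in E$ with $x_i\in e_{k_1}$, $x_j\in e_{k_l}$ and $e_{k_s}\cap e_{k_{s+1}}\neq\emptyset$ for $s=1,\dots,l-1$. Functions $V\to\mathbb{R}$ are identified with vectors in $\mathbb{R}^n$ with the standard inner product $\langle\cdot,\cdot\rangle$. Define $F_H(u)=\sum_{k=1}^m w_k\max_{x_i,x_j\in e_k}|u(x_i)-u(x_j)|^p$, and $F_H^{con}(u)=F_H(u)$ if $u(x_i)=y_i$ for all $x_i\in L$, $F_H^{con}(u)=+\infty$ otherwise. For a minimizer $u$ of $F_H^{con}$, $D(u)\subset V$ is the set of vertices $x_i$ such that for every nonzero constant $\varepsilon$ of sufficiently small absolute value, the function $v$ with $v(x_i)=u(x_i)+\varepsilon$ and $v(x_j)=u(x_j)$ for $j\ne i$ satisfies $F_H^{con}(v)>F_H^{con}(u)$. (In particular $L\subset D(u)$.) $B_k=\mathrm{conv}\{\mathbb{I}_{x_i}-\mathbb{I}_{x_j}:x_i,x_j\in e_k\}\subset\mathbb{R}^n$, where $\mathbb{I}_{x_i}$ is the indicator vector of $x_i$ (value $1$ at $x_i$ and $0$ elsewhere) and $\mathrm{conv}$ is the convex hull. For every minimizer $u$ of $F_H^{con}$,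 vectors $\beta_k$ with the property required in the claim exist, by the optimality condition $0\in\partial F_H^{con}(u)$. Convention: $|0|^{p-2}0=0$ (also for $1<p<2$); terms with $x_i\notin e_k$ are $0$. *)

theory Defs
  imports "HOL-Analysis.Analysis"
begin

text \<open>
  The vertices are distinct points \<open>x\<^sub>i\<close> in Euclidean space, enumerated by a finite index
  type \<open>'n\<close> (so \<open>n = CARD('n)\<close>).  A vertex is referred to by its index: sets of vertices
  (hyperedges, labelled sets, determined vertices) are sets of indices, and a function on the
  vertex set is the vector \<open>u :: real ^ 'n\<close> with \<open>u $ i\<close> being its value at \<open>x\<^sub>i\<close>.  The
  hyperedges form a family over a finite index type \<open>'m\<close>, so repeated hyperedges are allowed.
\<close>

record ('n, 'd, 'm) hypergraph =
  vertex :: "'n \<Rightarrow> real ^ ('d::finite)"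
  hedge :: "'m \<Rightarrow> 'n set"
  weight :: "'m \<Rightarrow> real"

definition is_hypergraph :: "('n::finite, 'd::finite, 'm::finite) hypergraph \<Rightarrow> bool" where
  "is_hypergraph H \<longleftrightarrow>
     inj (vertex H) \<and> (\<forall>k. hedge H k \<noteq> {}) \<and> (\<forall>k. weight H k > 0)"

definition hconnected :: "('n::finite, 'd::finite, 'm::finite) hypergraph \<Rightarrow> bool" where
  "hconnected H \<longleftrightarrow>
     (\<forall>i j. \<exists>ks. ks \<noteq> [] \<and> i \<in> hedge H (hd ks) \<and> j \<in> hedge H (last ks) \<and>
        successively (\<lambda>k k'. hedge H k \<inter> hedge H k' \<noteq> {}) ks)"

definition max_diff_powr :: "real ^ 'n \<Rightarrow> ('n::finite) set \<Rightarrow> real \<Rightarrow> real" where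
  "max_diff_powr u e q = Max {\<bar>u $ i - u $ j\<bar> powr q | i j. i \<in> e \<and> j \<in> e}"

definition F_H :: "('n::finite, 'd::finite, 'm::finite) hypergraph \<Rightarrow> real \<Rightarrow> real ^ 'n \<Rightarrow> real" where
  "F_H H p u = (\<Sum>k\<in>UNIV. weight H k * max_diff_powr u (hedge H k) p)"

text \<open>Only the values of \<open>y\<close> on \<open>L\<close> matter.\<close>

definition F_con ::
  "('n::finite, 'd::finite, 'm::finite) hypergraph \<Rightarrow> real \<Rightarrow> 'n set \<Rightarrow> ('n \<Rightarrow> real)
     \<Rightarrow> real ^ 'n \<Rightarrow> ereal" where
  "F_con H p L y u = (if \<forall>i\<in>L. u $ i = y i then ereal (F_H H p u) else \<infinity>)"

text \<open>
  \<open>u + axis i \<epsilon>\<close> changes the value of \<open>u\<close> at the single vertex \<open>i\<close> by \<open>\<epsilon>\<close>; the filter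
  \<open>at 0\<close> ranges over nonzero \<open>\<epsilon>\<close> of either sign and sufficiently small absolute value.
\<close>

definition determined ::
  "('n::finite, 'd::finite, 'm::finite) hypergraph \<Rightarrow> real \<Rightarrow> 'n set \<Rightarrow> ('n \<Rightarrow> real)
     \<Rightarrow> real ^ 'n \<Rightarrow> 'n set" where
  "determined H p L y u =
     {i. \<forall>\<^sub>F \<epsilon> in at (0::real). F_con H p L y (u + axis i \<epsilon>) > F_con H p L y u}"

definition B_set :: "('n::finite, 'd::finite, 'm::finite) hypergraph \<Rightarrow> 'm \<Rightarrow> (real ^ 'n) set" where
  "B_set H k = convex hull {axis i 1 - axis j 1 | i j. i \<in> hedge H k \<and> j \<in> hedge H k}"

text \<open>
  The equation on \<open>D\<close> for coefficients \<open>\<alpha>\<close>.  Only the values of \<open>v\<close> on \<open>D\<close> enter the first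
  part.  The convention that the terms with \<open>i \<notin> hedge H k\<close> vanish is realised by
  \<open>\<alpha> k i = 0\<close> for such \<open>k\<close>; this also covers the case \<open>hedge H k \<inter> D = {}\<close>, where \<open>Max\<close> and
  \<open>Min\<close> are unspecified.  Moreover \<open>\<bar>0\<bar> powr (p - 2) * 0 = 0\<close> for every \<open>p\<close>.
\<close>

definition p_laplacian_solution_on ::
  "('n::finite, 'd::finite, 'm::finite) hypergraph \<Rightarrow> real \<Rightarrow> ('m \<Rightarrow> 'n \<Rightarrow> real)
     \<Rightarrow> 'n set \<Rightarrow> ('n \<Rightarrow> real) \<Rightarrow> 'n set \<Rightarrow> ('n \<Rightarrow> real) \<Rightarrow> bool" where
  "p_laplacian_solution_on H p \<alpha> L y D v \<longleftrightarrow>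
     (\<forall>i\<in>D - L.
        (\<Sum>k\<in>UNIV. weight H k * \<alpha> k i *
           (let t = Max (v ` (hedge H k \<inter> D)) + Min (v ` (hedge H k \<inter> D)) - 2 * v i
            in \<bar>t\<bar> powr (p - 2) * t)) = 0) \<and>
     (\<forall>i\<in>L. v i = y i)"

end

theory Submission
  imports Defs
begin

text \<open>
  Write \<open>osc u e\<close> for the oscillation of \<open>u\<close> on a hyperedge \<open>e\<close>, so that \<open>F_H\<close> is the weighted sum of
  the \<open>p\<close>-th powers of the oscillations.  On an edge where \<open>u\<close> is not constant, a maximiser \<open>\<beta>\<close> of
  \<open>\<langle>b, u\<rangle>\<close> is positive only where \<open>u\<close> attains its maximum over the edge and negative only where it
  attains its minimum (\<open>maximizer_support\<close>).  So at a vertex \<open>i\<close> of the edge with \<open>\<beta> $ i \<noteq> 0\<close> the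
  quantity \<open>max + min - 2 u $ i\<close>, with extrema over the whole edge, is plus or minus the oscillation, its sign
  opposite to that of \<open>\<beta> $ i\<close>.  On an edge where \<open>u\<close> is constant both this quantity and the
  factor of \<open>\<beta>\<close> in the hypothesis vanish.  Hence the equation at \<open>i\<close> is the negative of the hypothesis on the \<open>\<beta> k\<close>.

  It remains to see that restricting the extrema to the determined vertices does not change them
  (\<open>extrema_determined\<close>).  Since \<open>t \<mapsto> t powr p\<close> is strictly convex, all minimisers have
  the same oscillation on each edge (\<open>minimizer_osc_unique\<close>), and the minimisers form the convex set of
  feasible functions whose oscillations do not exceed those of \<open>u\<close>.  If no vertex at which \<open>u\<close>
  attains its minimum over an edge were determined, each of them could be moved slightly, necessarily
  upwards, without leaving this set; the average of these moves would be a minimiser with a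
  strictly smaller oscillation on that edge (\<open>lowest_vertex_rigid\<close>).  The maximum is treated by
  changing signs.
\<close>

section \<open>Oscillation on a hyperedge\<close>

definition osc :: "real ^ 'n \<Rightarrow> ('n::finite) set \<Rightarrow> real" where
  "osc u e = Max (($) u ` e) - Min (($) u ` e)"

lemma diff_le_osc:
  assumes "i \<in> e" "j \<in> e"
  shows "u $ i - u $ j \<le> osc u e"
proof -
  have "u $ i \<le> Max (($) u ` e)" "Min (($) u ` e) \<le> u $ j"
    using assms by auto
  then show ?thesis by (simp add: osc_def)
qed

lemma extrema_attained:
  fixes u :: "real ^ 'n::finite"
  assumes "e \<noteq> {}"
  shows "\<exists>i\<in>e. \<exists>j\<in>e. u $ i = Max (($) u ` e) \<and> u $ j = Min (($) u ` e) \<and> osc u e = u $ i - u $ j"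
proof -
  have "Max (($) u ` e) \<in> ($) u ` e" "Min (($) u ` e) \<in> ($) u ` e"
    using assms by (auto intro!: Max_in Min_in)
  then obtain i j where "i \<in> e" "j \<in> e" "u $ i = Max (($) u ` e)" "u $ j = Min (($) u ` e)"
    by (metis imageE)
  then show ?thesis unfolding osc_def by metis
qed

lemma osc_leI:
  assumes "e \<noteq> {}" "\<And>i j. i \<in> e \<Longrightarrow> j \<in> e \<Longrightarrow> u $ i - u $ j \<le> r"
  shows "osc u e \<le> r"
proof -
  obtain i j where "i \<in> e" "j \<in> e" "osc u e = u $ i - u $ j"
    using extrema_attained[OF assms(1), of u] by blast
  then show ?thesis using assms(2) by simp
qed

lemma osc_nonneg:
  assumes "e \<noteq> {}"
  shows "0 \<le> osc u e"
proof -
  obtain i where "i \<in> e" using assms by blast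
  then show ?thesis using diff_le_osc[of i e i u] by simp
qed

lemma osc_uminus:
  fixes u :: "real ^ 'n::finite"
  assumes "e \<noteq> {}"
  shows "osc (- u) e = osc u e"
proof -
  have le: "osc (- v) e \<le> osc v e" for v :: "real ^ 'n"
    using diff_le_osc[of _ e _ v] by (intro osc_leI assms) (simp add: algebra_simps)
  show ?thesis using le[of u] le[of "- u"] by simp
qed

lemma osc_midpoint:
  assumes "e \<noteq> {}"
  shows "osc ((1/2) *\<^sub>R (u + v)) e \<le> (osc u e + osc v e) / 2"
proof (intro osc_leI assms)
  fix i j assume "i \<in> e" "j \<in> e"
  then show "((1/2) *\<^sub>R (u + v)) $ i - ((1/2) *\<^sub>R (u + v)) $ j \<le> (osc u e + osc v e) / 2"
    using diff_le_osc[of i e j u] diff_le_osc[of i e j v] by (simp add: field_simps)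
qed

lemma max_diff_powr_eq_osc:
  fixes u :: "real ^ 'n::finite"
  assumes "e \<noteq> {}" "q > 0"
  shows "max_diff_powr u e q = osc u e powr q"
  unfolding max_diff_powr_def
proof (rule Max_eqI)
  have "{\<bar>u $ i - u $ j\<bar> powr q | i j. i \<in> e \<and> j \<in> e}
      = (\<lambda>(i, j). \<bar>u $ i - u $ j\<bar> powr q) ` (e \<times> e)" by auto
  then show "finite {\<bar>u $ i - u $ j\<bar> powr q | i j. i \<in> e \<and> j \<in> e}" by simp
next
  fix t assume "t \<in> {\<bar>u $ i - u $ j\<bar> powr q | i j. i \<in> e \<and> j \<in> e}"
  then obtain i j where ij: "i \<in> e" "j \<in> e" "t = \<bar>u $ i - u $ j\<bar> powr q" by auto
  have "\<bar>u $ i - u $ j\<bar> \<le> osc u e"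
    using diff_le_osc[of i e j u] diff_le_osc[of j e i u] ij by (simp add: abs_le_iff)
  then show "t \<le> osc u e powr q" using ij assms by (simp add: powr_mono2)
next
  obtain i j where ij: "i \<in> e" "j \<in> e" "osc u e = u $ i - u $ j"
    using extrema_attained[OF assms(1), of u] by blast
  then have eq: "osc u e powr q = \<bar>u $ i - u $ j\<bar> powr q"
    using osc_nonneg[OF assms(1), of u] by simp
  show "osc u e powr q \<in> {\<bar>u $ i - u $ j\<bar> powr q | i j. i \<in> e \<and> j \<in> e}"
    unfolding eq using ij(1,2) by blast
qed

lemma F_H_eq_osc:
  assumes "is_hypergraph H" "p > 0"
  shows "F_H H p u = (\<Sum>k\<in>UNIV. weight H k * osc u (hedge H k) powr p)"
  unfolding F_H_def using assms by (intro sum.cong) (simp_all add: is_hypergraph_def max_diff_powr_eq_osc)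

section \<open>Oscillations of minimisers\<close>

text \<open>
  By the mean value theorem the increments over the two halves of the interval are governed by
  the derivative \<open>p * x powr (p - 1)\<close>, which is strictly increasing.
\<close>

lemma powr_midpoint_strict:
  fixes a b p :: real
  assumes "p > 1" "0 \<le> a" "0 \<le> b" "a \<noteq> b"
  shows "((a + b) / 2) powr p < (a powr p + b powr p) / 2"
proof -
  have main: "((a + b) / 2) powr p < (a powr p + b powr p) / 2" if a: "0 \<le> a" and ab: "a < b" for a b :: real
  proof -
    define c where "c = (a + b) / 2"
    have c: "a < c" "c < b" "b - c = c - a" using ab by (auto simp: c_def field_simps)
    have mvt: "\<exists>z. x < z \<and> z < y \<and> y powr p - x powr p = (y - x) * (p * z powr (p - 1))"
      if "0 \<le> x" "x < y" for x y :: real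
    proof -
      have "continuous_on {x..y} (\<lambda>z. z powr p)"
        using that assms by (intro continuous_on_powr' continuous_on_id continuous_on_const) auto
      moreover have deriv: "((\<lambda>z. z powr p) has_real_derivative p * z powr (p - 1)) (at z)"
        if "x < z" for z
        using \<open>0 \<le> x\<close> that by (intro has_real_derivative_powr) simp
      ultimately obtain l z where z: "x < z" "z < y"
        and l: "((\<lambda>z. z powr p) has_real_derivative l) (at z)" "y powr p - x powr p = (y - x) * l"
        using MVT[of x y "\<lambda>z. z powr p"] \<open>x < y\<close> unfolding real_differentiable_def by blast
      have "l = p * z powr (p - 1)"
        using DERIV_unique[OF l(1) deriv[OF z(1)]] .
      then show ?thesis using z l(2) by blast
    qed
    obtain s where s: "a < s" "s < c" "c powr p - a powr p = (c - a) * (p * s powr (p - 1))"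
      using mvt[of a c] a c(1) by blast
    obtain t where t: "c < t" "t < b" "b powr p - c powr p = (b - c) * (p * t powr (p - 1))"
      using mvt[of c b] a c(1,2) by force
    have "s powr (p - 1) < t powr (p - 1)"
      using s t a assms by (intro powr_less_mono2) auto
    then have "(c - a) * (p * s powr (p - 1)) < (c - a) * (p * t powr (p - 1))"
      using c(1) assms(1) by (intro mult_strict_left_mono) auto
    then have "c powr p - a powr p < b powr p - c powr p"
      by (simp only: s(3) t(3) c(3))
    then show ?thesis by (simp add: c_def)
  qed
  show ?thesis
    using main[of a b] main[of b a] assms by (cases "a < b") (auto simp: add.commute)
qed

text \<open>
  At the midpoint of two minimisers with different oscillations on some edge, strict convexity
  would give a value of \<open>F_H\<close> below the minimum.
\<close>

lemma minimizer_osc_unique: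
  assumes H: "is_hypergraph H" and p: "p > 1"
    and min: "\<And>v. \<forall>i\<in>L. v $ i = y i \<Longrightarrow> F_H H p u \<le> F_H H p v"
    and u: "\<forall>i\<in>L. u $ i = y i" and v: "\<forall>i\<in>L. v $ i = y i"
    and le: "F_H H p v \<le> F_H H p u"
  shows "osc v (hedge H k) = osc u (hedge H k)"
proof (rule ccontr)
  assume ne: "osc v (hedge H k) \<noteq> osc u (hedge H k)"
  have e: "hedge H k \<noteq> {}" and w: "weight H k > 0" for k
    using H by (auto simp: is_hypergraph_def)
  define z where "z = (1/2) *\<^sub>R (u + v)"
  let ?avg = "\<lambda>k. (osc u (hedge H k) powr p + osc v (hedge H k) powr p) / 2"
  have mono: "osc z (hedge H l) powr p \<le> ((osc u (hedge H l) + osc v (hedge H l)) / 2) powr p" for l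
    unfolding z_def using p osc_midpoint[OF e, of u v l] osc_nonneg[OF e]
    by (intro powr_mono2) auto
  have strict: "osc z (hedge H l) powr p < ?avg l"
    if "osc v (hedge H l) \<noteq> osc u (hedge H l)" for l
    using powr_midpoint_strict[of p "osc u (hedge H l)" "osc v (hedge H l)"]
      p that osc_nonneg[OF e] mono[of l] by fastforce
  have weak: "osc z (hedge H l) powr p \<le> ?avg l" for l
    using strict[of l] mono[of l] by (cases "osc v (hedge H l) = osc u (hedge H l)") auto
  have "F_H H p z = (\<Sum>l\<in>UNIV. weight H l * osc z (hedge H l) powr p)"
    using H p by (simp add: F_H_eq_osc)
  also have "\<dots> < (\<Sum>l\<in>UNIV. weight H l * ?avg l)"
  proof (rule sum_strict_mono_ex1)
    show "\<forall>l\<in>UNIV. weight H l * osc z (hedge H l) powr p \<le> weight H l * ?avg l"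
      using w weak by (simp add: less_imp_le mult_left_mono)
    show "\<exists>l\<in>UNIV. weight H l * osc z (hedge H l) powr p < weight H l * ?avg l"
      using w strict[OF ne] by (meson UNIV_I mult_strict_left_mono)
  qed simp
  also have "\<dots> = (F_H H p u + F_H H p v) / 2"
    using H p by (simp add: F_H_eq_osc distrib_left add_divide_distrib sum.distrib sum_divide_distrib)
  also have "\<dots> \<le> F_H H p u" using le by simp
  finally have "F_H H p z < F_H H p u" .
  moreover have "\<forall>i\<in>L. z $ i = y i" using u v by (simp add: z_def)
  ultimately show False using min[of z] by simp
qed

section \<open>Extrema are attained at determined vertices\<close>

text \<open>
  Otherwise every vertex of the set \<open>A\<close> where the minimum over \<open>e\<close> is attained admits arbitrarily small moves
  inside \<open>C\<close>.  These cannot go downwards, which would increase the oscillation, and the average over \<open>A\<close> of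
  small upward moves raises the minimum without affecting the maximum.
\<close>

lemma lowest_vertex_rigid:
  fixes u :: "real ^ 'n::finite"
  assumes C: "convex C"
    and osc: "\<And>v. v \<in> C \<Longrightarrow> osc v e = osc u e"
    and e: "e \<noteq> {}" and pos: "osc u e > 0"
  shows "\<exists>j\<in>e. u $ j = Min (($) u ` e) \<and> (\<forall>\<^sub>F \<epsilon> in at 0. u + axis j \<epsilon> \<notin> C)"
proof (rule ccontr)
  assume neg: "\<not> ?thesis"
  obtain a b where ab: "a \<in> e" "b \<in> e" "u $ a = Max (($) u ` e)" "u $ b = Min (($) u ` e)"
    "osc u e = u $ a - u $ b"
    using extrema_attained[OF e, of u] by blast
  define A where "A = {j \<in> e. u $ j = u $ b}"
  have bA: "b \<in> A" using ab by (simp add: A_def)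
  then have card: "real (card A) \<ge> 1"
    by (simp add: Suc_le_eq card_gt_0_iff) blast
  then have nz: "real (card A) \<noteq> 0" by linarith
  have "\<exists>\<epsilon>. \<epsilon> \<noteq> 0 \<and> \<bar>\<epsilon>\<bar> < osc u e \<and> u + axis j \<epsilon> \<in> C" if "j \<in> A" for j
  proof -
    have "\<not> (\<forall>\<^sub>F \<epsilon> in at 0. u + axis j \<epsilon> \<notin> C)"
      using neg that ab by (auto simp: A_def)
    then show ?thesis using pos by (auto simp: eventually_at dist_real_def)
  qed
  then obtain \<epsilon> where \<epsilon>: "\<And>j. j \<in> A \<Longrightarrow> \<epsilon> j \<noteq> 0 \<and> \<bar>\<epsilon> j\<bar> < osc u e \<and> u + axis j (\<epsilon> j) \<in> C"
    by metis
  have up: "\<epsilon> j > 0" if "j \<in> A" for j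
  proof -
    have "a \<noteq> j" "j \<in> e" using that ab pos by (auto simp: A_def)
    then have "u $ a - (u $ j + \<epsilon> j) \<le> osc (u + axis j (\<epsilon> j)) e"
      using diff_le_osc[of a e j "u + axis j (\<epsilon> j)"] ab by (simp add: axis_def)
    then have "u $ a - (u $ j + \<epsilon> j) \<le> osc u e" using osc \<epsilon> that by simp
    then show ?thesis using ab that \<epsilon>[OF that] by (simp add: A_def)
  qed
  define v where "v = (\<Sum>j\<in>A. (1 / card A) *\<^sub>R (u + axis j (\<epsilon> j)))"
  have "v \<in> C"
    unfolding v_def using C card \<epsilon> by (intro convex_sum) auto
  have v: "v $ i = u $ i + (if i \<in> A then \<epsilon> i / card A else 0)" for i
  proof -
    have "v $ i = (\<Sum>j\<in>A. u $ i / card A + (if j = i then \<epsilon> j / card A else 0))"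
      unfolding v_def sum_component by (rule sum.cong) (simp_all add: axis_def add_divide_distrib)
    moreover have "(\<Sum>j\<in>A. u $ i / card A) = u $ i"
      using nz by simp
    moreover have "(\<Sum>j\<in>A. (if j = i then \<epsilon> j / card A else 0)) = (if i \<in> A then \<epsilon> i / card A else 0)"
      by (rule sum.delta) simp
    ultimately show ?thesis by (simp only: sum.distrib)
  qed
  \<comment> \<open>A move shorter than the oscillation cannot exceed the old maximum, while every vertex at the old
    minimum has left it.\<close>
  obtain s t where st: "s \<in> e" "t \<in> e" "osc v e = v $ s - v $ t"
    using extrema_attained[OF e, of v] by blast
  have "u $ s \<le> u $ a" "u $ b \<le> u $ t" unfolding ab(3,4) using st by auto
  have "v $ s \<le> u $ a"
  proof (cases "s \<in> A")
    case True
    have "\<epsilon> s / card A \<le> \<epsilon> s" using card up[OF True] by (simp add: field_simps)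
    moreover have "v $ s = u $ b + \<epsilon> s / card A" using v[of s] True by (simp add: A_def)
    moreover have "\<epsilon> s \<le> u $ a - u $ b" using \<epsilon>[OF True] ab(5) by linarith
    ultimately show ?thesis by simp
  qed (use v \<open>u $ s \<le> u $ a\<close> in simp)
  moreover have "v $ t > u $ b"
  proof (cases "t \<in> A")
    case True
    have "\<epsilon> t / card A > 0" using card up[OF True] by simp
    then show ?thesis using v[of t] True by (simp add: A_def)
  qed (use v \<open>u $ b \<le> u $ t\<close> st in \<open>auto simp: A_def\<close>)
  ultimately show False using osc[OF \<open>v \<in> C\<close>] st ab by simp
qed

lemma arg_min_F_con:
  assumes "is_arg_min (F_con H p L y) (\<lambda>_. True) u"
  shows "\<forall>i\<in>L. u $ i = y i" and "\<forall>i\<in>L. v $ i = y i \<Longrightarrow> F_H H p u \<le> F_H H p v"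
proof -
  have le: "F_con H p L y u \<le> F_con H p L y v" for v
    using assms by (auto simp: is_arg_min_def not_less)
  show "\<forall>i\<in>L. u $ i = y i"
    using le[of "\<chi> i. y i"] by (auto simp: F_con_def split: if_splits)
  then show "\<forall>i\<in>L. v $ i = y i \<Longrightarrow> F_H H p u \<le> F_H H p v"
    using le[of v] by (simp add: F_con_def)
qed

lemma labels_determined:
  assumes "is_arg_min (F_con H p L y) (\<lambda>_. True) u"
  shows "L \<subseteq> determined H p L y u"
proof
  fix i assume i: "i \<in> L"
  have u: "\<forall>i\<in>L. u $ i = y i" using arg_min_F_con[OF assms] by blast
  have "F_con H p L y u < F_con H p L y (u + axis i \<epsilon>)" if "\<epsilon> \<noteq> 0" for \<epsilon>
    using that i u by (auto simp: F_con_def axis_def)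
  then show "i \<in> determined H p L y u"
    by (auto simp: determined_def eventually_at intro: exI[of _ 1])
qed

text \<open>
  The convex set used here is a description of the set of minimisers by linear constraints;
  a function satisfying them cannot have a smaller oscillation than \<open>u\<close> on any edge, by minimality.
\<close>

lemma extrema_determined:
  assumes H: "is_hypergraph H" and p: "p > 1"
    and min: "is_arg_min (F_con H p L y) (\<lambda>_. True) u"
    and pos: "osc u (hedge H k) > 0"
  defines "e \<equiv> hedge H k" and "D \<equiv> determined H p L y u"
  shows "Min (($) u ` (e \<inter> D)) = Min (($) u ` e)" and "Max (($) u ` (e \<inter> D)) = Max (($) u ` e)"
proof -
  note feas = arg_min_F_con(1)[OF min] and opt = arg_min_F_con(2)[OF min]
  have ne: "hedge H k \<noteq> {}" and w: "weight H k > 0" for k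
    using H by (auto simp: is_hypergraph_def)
  define C where "C = (\<Inter>i\<in>L. {v. v $ i = y i}) \<inter>
    (\<Inter>k. \<Inter>i\<in>hedge H k. \<Inter>j\<in>hedge H k. {v. v $ i - v $ j \<le> osc u (hedge H k)})"
  have "convex {v :: real ^ 'a. v $ i = c}" "convex {v :: real ^ 'a. v $ i - v $ j \<le> c}" for i j c
  proof -
    have "{v :: real ^ 'a. v $ i = c} = {v. axis i 1 \<bullet> v = c}"
      "{v :: real ^ 'a. v $ i - v $ j \<le> c} = {v. (axis i 1 - axis j 1) \<bullet> v \<le> c}"
      by (simp_all add: inner_diff_left inner_axis')
    then show "convex {v :: real ^ 'a. v $ i = c}" "convex {v :: real ^ 'a. v $ i - v $ j \<le> c}"
      by (simp_all only: convex_hyperplane convex_halfspace_le)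
  qed
  then have C: "convex C"
    unfolding C_def by (intro convex_Int convex_INT) auto
  have C_feas: "\<forall>i\<in>L. v $ i = y i" if "v \<in> C" for v using that by (auto simp: C_def)
  have C_osc_le: "osc v (hedge H l) \<le> osc u (hedge H l)" if "v \<in> C" for v l
    using that by (intro osc_leI ne) (auto simp: C_def)
  have C_osc: "osc v e = osc u e" if v: "v \<in> C" for v
  proof -
    have "F_H H p v \<le> F_H H p u"
      unfolding F_H_eq_osc[OF H less_trans[OF zero_less_one p]]
      using C_osc_le[OF v] w p osc_nonneg[OF ne]
      by (intro sum_mono mult_left_mono powr_mono2) (auto simp: less_imp_le)
    then show ?thesis
      unfolding e_def using minimizer_osc_unique[OF H p opt feas C_feas[OF v]] by blast
  qed
  have det: "j \<in> D" if "\<forall>\<^sub>F \<epsilon> in at 0. u + axis j \<epsilon> \<notin> C" for j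
  proof -
    have "F_con H p L y u < F_con H p L y v" if "v \<notin> C" for v
    proof (rule ccontr)
      assume "\<not> ?thesis"
      then have v: "\<forall>i\<in>L. v $ i = y i" "F_H H p v \<le> F_H H p u"
        using feas by (auto simp: F_con_def not_less split: if_splits)
      have "osc v (hedge H l) = osc u (hedge H l)" for l
        using minimizer_osc_unique[OF H p opt feas v] by blast
      then have "v \<in> C"
        using v(1) by (auto simp: C_def) (metis diff_le_osc)
      with that show False ..
    qed
    then show ?thesis
      unfolding D_def determined_def using that by (auto elim: eventually_mono)
  qed
  obtain j where j: "j \<in> e" "u $ j = Min (($) u ` e)" "j \<in> D"
    using lowest_vertex_rigid[OF C C_osc] ne pos det unfolding e_def by blast
  have "\<exists>i\<in>e. (- u) $ i = Min (($) (- u) ` e) \<and> (\<forall>\<^sub>F \<epsilon> in at 0. - u + axis i \<epsilon> \<notin> uminus ` C)"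
  proof (rule lowest_vertex_rigid)
    show "convex (uminus ` C)" using C by (rule convex_negations)
    show "osc v e = osc (- u) e" if "v \<in> uminus ` C" for v
      using that C_osc ne by (auto simp: osc_uminus e_def)
    show "e \<noteq> {}" "osc (- u) e > 0" using ne pos by (auto simp: osc_uminus e_def)
  qed
  then obtain i where i: "i \<in> e" "(- u) $ i = Min (($) (- u) ` e)"
    and ev: "\<forall>\<^sub>F \<epsilon> in at 0. - u + axis i \<epsilon> \<notin> uminus ` C" by blast
  have flip: "- u + axis i (- \<epsilon>) = - (u + axis i \<epsilon>)" for \<epsilon> :: real
    by (simp add: vec_eq_iff axis_def)
  obtain d where d: "d > 0" "\<And>\<epsilon>. \<epsilon> \<noteq> 0 \<Longrightarrow> \<bar>\<epsilon>\<bar> < d \<Longrightarrow> - u + axis i \<epsilon> \<notin> uminus ` C"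
    using ev by (auto simp: eventually_at dist_real_def)
  have "u + axis i \<epsilon> \<notin> C" if "\<epsilon> \<noteq> 0" "\<bar>\<epsilon>\<bar> < d" for \<epsilon>
  proof -
    have "- (u + axis i \<epsilon>) \<notin> uminus ` C"
      using d(2)[of "- \<epsilon>"] that by (simp only: flip abs_minus_cancel neg_equal_0_iff_equal not_False_eq_True)
    then show ?thesis by blast
  qed
  then have "\<forall>\<^sub>F \<epsilon> in at 0. u + axis i \<epsilon> \<notin> C"
    using d(1) by (auto simp: eventually_at dist_real_def)
  then have iD: "i \<in> D" by (rule det)
  have i_max: "u $ s \<le> u $ i" if "s \<in> e" for s
  proof -
    have "(- u) $ i \<le> (- u) $ s" unfolding i(2) using that by (intro Min_le) auto
    then show ?thesis by simp
  qed
  have j_min: "u $ j \<le> u $ s" if "s \<in> e" for s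
    unfolding j(2) using that by (intro Min_le) auto
  have "Min (($) u ` (e \<inter> D)) = u $ j"
  proof (rule Min_eqI)
    show "u $ j \<in> ($) u ` (e \<inter> D)" using j(1,3) by blast
  qed (use j_min in auto)
  then show "Min (($) u ` (e \<inter> D)) = Min (($) u ` e)" using j(2) by simp
  have "Max (($) u ` (e \<inter> D)) = u $ i"
    using i iD i_max by (intro Max_eqI) auto
  moreover have "Max (($) u ` e) = u $ i"
    using i i_max by (intro Max_eqI) auto
  ultimately show "Max (($) u ` (e \<inter> D)) = Max (($) u ` e)" by simp
qed

section \<open>Support of the maximising vectors\<close>

lemma B_set_inner_le:
  assumes b: "b \<in> B_set H k"
    and bounds: "\<And>j. j \<in> hedge H k \<Longrightarrow> lo \<le> w $ j \<and> w $ j \<le> hi"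
  shows "b \<bullet> w \<le> hi - lo"
proof -
  have "B_set H k \<subseteq> {b. w \<bullet> b \<le> hi - lo}"
    unfolding B_set_def
  proof (rule hull_minimal)
    show "{axis i 1 - axis j 1 | i j. i \<in> hedge H k \<and> j \<in> hedge H k} \<subseteq> {b. w \<bullet> b \<le> hi - lo}"
    proof clarify
      fix i j assume "i \<in> hedge H k" "j \<in> hedge H k"
      then show "w \<bullet> (axis i 1 - axis j 1) \<le> hi - lo"
        using bounds[of i] bounds[of j] by (simp add: inner_diff_right inner_axis)
    qed
  qed (rule convex_halfspace_le)
  then show ?thesis using b by (auto simp: inner_commute)
qed

text \<open>
  Changing the value of \<open>u\<close> at \<open>i\<close> to the maximum or minimum over the edge keeps all values on
  the edge within the same bounds, so \<open>\<langle>\<beta>, \<cdot>\<rangle>\<close> cannot increase beyond its value at \<open>u\<close>, which is already the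
  oscillation.
\<close>

lemma maximizer_support:
  assumes e: "hedge H k \<noteq> {}" and i: "i \<in> hedge H k"
    and \<beta>: "is_arg_max (\<lambda>b. b \<bullet> u) (\<lambda>b. b \<in> B_set H k) \<beta>"
  shows "\<beta> $ i > 0 \<Longrightarrow> u $ i = Max (($) u ` hedge H k)"
    and "\<beta> $ i < 0 \<Longrightarrow> u $ i = Min (($) u ` hedge H k)"
proof -
  define M m where "M = Max (($) u ` hedge H k)" and "m = Min (($) u ` hedge H k)"
  have bounds: "m \<le> u $ j" "u $ j \<le> M" if "j \<in> hedge H k" for j
    using that by (auto simp: M_def m_def)
  obtain a b where ab: "a \<in> hedge H k" "b \<in> hedge H k" "u $ a = M" "u $ b = m"
    using extrema_attained[OF e, of u] unfolding M_def m_def by blast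
  have "axis a 1 - axis b 1 \<in> B_set H k"
    unfolding B_set_def using ab by (intro hull_inc) auto
  then have "(axis a 1 - axis b 1) \<bullet> u \<le> \<beta> \<bullet> u"
    using \<beta> by (auto simp: is_arg_max_def not_less)
  then have lower: "M - m \<le> \<beta> \<bullet> u" using ab by (simp add: inner_diff_left inner_axis')
  have le: "\<beta> $ i * (c - u $ i) \<le> 0" if "m \<le> c" "c \<le> M" for c
  proof -
    have "\<beta> \<bullet> (u + axis i (c - u $ i)) \<le> M - m"
    proof (rule B_set_inner_le)
      show "\<beta> \<in> B_set H k" using \<beta> by (simp add: is_arg_max_def)
      show "m \<le> (u + axis i (c - u $ i)) $ j \<and> (u + axis i (c - u $ i)) $ j \<le> M"
        if "j \<in> hedge H k" for j
        using bounds[OF that] \<open>m \<le> c\<close> \<open>c \<le> M\<close> by (simp add: axis_def)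
    qed
    then show ?thesis using lower by (simp add: inner_add_right inner_axis)
  qed
  show "\<beta> $ i > 0 \<Longrightarrow> u $ i = Max (($) u ` hedge H k)"
    using le[of M] bounds[OF i] by (simp add: mult_le_0_iff flip: M_def)
  show "\<beta> $ i < 0 \<Longrightarrow> u $ i = Min (($) u ` hedge H k)"
    using le[of m] bounds[OF i] by (simp add: mult_le_0_iff flip: m_def)
qed

section \<open>The equation on the determined vertices\<close>

theorem theorem2p5:
  fixes H :: "('n::finite, 'd::finite, 'm::finite) hypergraph"
    and p :: real and L :: "'n set" and y :: "'n \<Rightarrow> real"
    and u :: "real ^ 'n" and \<beta> :: "'m \<Rightarrow> real ^ 'n" and D :: "'n set"
    and \<alpha> :: "'m \<Rightarrow> 'n \<Rightarrow> real"
  assumes "p > 1"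
    and "is_hypergraph H"
    and "hconnected H"
    and "L \<noteq> {}"
    and "is_arg_min (F_con H p L y) (\<lambda>_. True) u"
    and "D = determined H p L y u"
    and "\<And>k. is_arg_max (\<lambda>b. b \<bullet> u) (\<lambda>b. b \<in> B_set H k) (\<beta> k)"
    and "\<And>i. i \<notin> L \<Longrightarrow>
           (\<Sum>k\<in>UNIV. (weight H k * max_diff_powr u (hedge H k) (p - 1)) *\<^sub>R \<beta> k) $ i = 0"
    and "\<And>k i. i \<in> D \<Longrightarrow> \<alpha> k i = (if i \<in> hedge H k then \<bar>\<beta> k $ i\<bar> else 0)"
  shows "p_laplacian_solution_on H p \<alpha> L y D (restrict (($) u) D)"
proof -
  note p = assms(1) and H = assms(2) and min = assms(5) and D = assms(6) and \<beta> = assms(7)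
    and crit = assms(8) and \<alpha> = assms(9)
  have e: "hedge H k \<noteq> {}" for k using H by (simp add: is_hypergraph_def)
  have term_eq: "weight H k * \<alpha> k i *
        (let t = Max (restrict (($) u) D ` (hedge H k \<inter> D)) + Min (restrict (($) u) D ` (hedge H k \<inter> D))
               - 2 * restrict (($) u) D i in \<bar>t\<bar> powr (p - 2) * t)
      = - (weight H k * max_diff_powr u (hedge H k) (p - 1) * \<beta> k $ i)"
    if i: "i \<in> D" for i k
  proof -
    let ?e = "hedge H k"
    have img: "restrict (($) u) D ` (?e \<inter> D) = ($) u ` (?e \<inter> D)" by auto
    define t where "t = Max (($) u ` (?e \<inter> D)) + Min (($) u ` (?e \<inter> D)) - 2 * u $ i"
    have "\<alpha> k i * (\<bar>t\<bar> powr (p - 2) * t) = - (osc u ?e powr (p - 1) * \<beta> k $ i)"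
    proof (cases "i \<in> ?e")
      case False
      \<comment> \<open>All elements of \<open>B_set H k\<close> vanish outside the edge: bound the inner products with \<open>axis i 1\<close>
        and its negative, which are zero on the edge.\<close>
      have "\<beta> k \<bullet> axis i c \<le> 0 - 0" for c
      proof (rule B_set_inner_le)
        show "\<beta> k \<in> B_set H k" using \<beta>[of k] by (simp add: is_arg_max_def)
      qed (use False in \<open>auto simp: axis_def\<close>)
      from this[of 1] this[of "-1"] have "\<beta> k $ i = 0" by (simp add: inner_axis)
      then show ?thesis using False \<alpha>[OF i] by simp
    next
      case ie: True
      then have \<alpha>i: "\<alpha> k i = \<bar>\<beta> k $ i\<bar>" using \<alpha>[OF i] by simp
      show ?thesis
      proof (cases "osc u ?e > 0")
        case False
        then have osc0: "osc u ?e = 0" using osc_nonneg[OF e[of k], of u] by linarith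
        have const: "u $ s = u $ i" if "s \<in> ?e" for s
          using diff_le_osc[of s ?e i u] diff_le_osc[of i ?e s u] that ie osc0 by simp
        have "($) u ` (?e \<inter> D) = (\<lambda>_. u $ i) ` (?e \<inter> D)"
          by (intro image_cong refl) (metis IntD1 const)
        also have "\<dots> = {u $ i}" using ie i by blast
        finally have "($) u ` (?e \<inter> D) = {u $ i}" .
        then have "t = 0" by (simp add: t_def)
        then show ?thesis using osc0 by simp
      next
        case pos: True
        have t: "t = Max (($) u ` ?e) + Min (($) u ` ?e) - 2 * u $ i"
          unfolding t_def D using extrema_determined[OF H p min pos] by simp
        have pw: "osc u ?e powr (p - 2) * osc u ?e = osc u ?e powr (p - 1)"
          using powr_add[of "osc u ?e" "p - 2" 1] pos by (simp add: add.commute)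
        consider "\<beta> k $ i = 0" | "\<beta> k $ i > 0" | "\<beta> k $ i < 0" by linarith
        then show ?thesis
        proof cases
          case 1
          then show ?thesis by (simp add: \<alpha>i)
        next
          case 2
          then have "t = - osc u ?e"
            using maximizer_support(1)[OF e ie \<beta>] by (simp add: t osc_def)
          then show ?thesis using 2 pos by (simp add: \<alpha>i pw)
        next
          case 3
          then have "t = osc u ?e"
            using maximizer_support(2)[OF e ie \<beta>] by (simp add: t osc_def)
          then show ?thesis using 3 pos by (simp add: \<alpha>i pw)
        qed
      qed
    qed
    then show ?thesis
      unfolding img using i p e
      by (simp add: Let_def t_def[symmetric] max_diff_powr_eq_osc mult.assoc)
  qed
  have crit': "(\<Sum>k\<in>UNIV. - (weight H k * max_diff_powr u (hedge H k) (p - 1) * \<beta> k $ i)) = 0"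
    if "i \<notin> L" for i
    using crit[OF that] by (simp add: sum_negf)
  show ?thesis
    unfolding p_laplacian_solution_on_def
  proof (intro conjI ballI, goal_cases)
    case (1 i)
    then have "i \<in> D" "i \<notin> L" by auto
    then show ?case using crit'[OF \<open>i \<notin> L\<close>] by (simp only: term_eq)
  next
    case (2 i)
    then show ?case using labels_determined[OF min] arg_min_F_con(1)[OF min] D by auto
  qed
qed

end
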